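(* Let $G$ be an undirected, connected, loop-free multigraph with $n\ge 2$ vertices, genus $g\ge 1$ and stretch factor $\kappa$. Let $r$ and $d$ be non-negative real numbers with $d\le 2g-2$. If $$g-\kappa(r+1)(g-d+r)\ge 0,$$ then there exists an $\mathbb{R}$-divisor on $G$ of degree at most $d$ and rank equal to $r$.
   Context: For a connected, loop-free multigraph $G=(V,E)$ with $n$ vertices and $m$ edges, the genus is $g=m-n+1$. The stretch factor $\kappa$ of $G$ is $\max\{\lceil n(n-1)/m\rceil,1\}$. An $\mathbb{R}$-divisor on $G$ is a formal sum $\sum_{v\in V}a_v(v)$ with $a_v\in\mathbb{R}$; its degree is $\sum_v a_v$; it is effective if $a_v\ge 0$ for all $v$. For $f:V\to\mathbb{Z}$ let $Q(f)=\sum_{v\in V}\big(\sum_{(u,v)\in E}(f(v)-f(u))\big)(v)$ (edges counted with multiplicity). Two $\mathbb{R}$-divisors $D_1,D_2$ are linearly equivalent if $D_1-D_2=Q(f)$ for some $f:V\to\mathbb{Z}$. The linear system $|D|$ is the set of effective $\mathbb{R}$-divisors linearly equivalent to $D$. The modified rank $\tilde r(D)$ is $k_0-1$, where $k_0$ is the infimum of all $k$ such that there is an effective $\mathbb{R}$-divisor $E$ of degree $k$ with $|D-E|=\emptyset$. The rank of $D$ is $r(D)=\tilde r\big(D+\sum_{v\in V}(v)\big)$. *)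

theory Defs
  imports "HOL-Analysis.Analysis" "HOL-Library.Multiset"
begin

text \<open>
  A finite undirected loop-free multigraph is given by a vertex set \<open>V\<close> and a multiset \<open>E\<close> of
  two-element subsets of \<open>V\<close>; the number of parallel edges joining \<open>u\<close> and \<open>v\<close> is
  \<open>count E {u, v}\<close>.
\<close>

definition multigraph :: "'v set \<Rightarrow> 'v set multiset \<Rightarrow> bool" where
  "multigraph V E \<longleftrightarrow> finite V \<and> V \<noteq> {} \<and> (\<forall>e \<in># E. e \<subseteq> V \<and> card e = 2)"

definition connected_multigraph :: "'v set \<Rightarrow> 'v set multiset \<Rightarrow> bool" where
  "connected_multigraph V E \<longleftrightarrow>
     multigraph V E \<and> (\<forall>u\<in>V. \<forall>v\<in>V. (u, v) \<in> {(x, y). {x, y} \<in># E}\<^sup>*)"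

definition genus :: "'v set \<Rightarrow> 'v set multiset \<Rightarrow> int" where
  "genus V E = int (size E) - int (card V) + 1"

definition stretch_factor :: "'v set \<Rightarrow> 'v set multiset \<Rightarrow> int" where
  "stretch_factor V E =
     max \<lceil>real (card V) * (real (card V) - 1) / real (size E)\<rceil> 1"

text \<open>Formal real linear combinations of vertices are functions that vanish outside \<open>V\<close>.\<close>

definition divisors :: "'v set \<Rightarrow> ('v \<Rightarrow> real) set" where
  "divisors V = {D. \<forall>v. v \<notin> V \<longrightarrow> D v = 0}"

definition deg :: "'v set \<Rightarrow> ('v \<Rightarrow> real) \<Rightarrow> real" where
  "deg V D = (\<Sum>v\<in>V. D v)"

definition effective :: "'v set \<Rightarrow> ('v \<Rightarrow> real) \<Rightarrow> bool" where
  "effective V D \<longleftrightarrow> D \<in> divisors V \<and> (\<forall>v\<in>V. D v \<ge> 0)"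

text \<open>The term \<open>u = v\<close> below contributes nothing.\<close>

definition Q :: "'v set \<Rightarrow> 'v set multiset \<Rightarrow> ('v \<Rightarrow> int) \<Rightarrow> 'v \<Rightarrow> real" where
  "Q V E f = (\<lambda>v. if v \<in> V
     then of_int (\<Sum>u\<in>V. int (count E {u, v}) * (f v - f u)) else 0)"

definition lin_equiv ::
    "'v set \<Rightarrow> 'v set multiset \<Rightarrow> ('v \<Rightarrow> real) \<Rightarrow> ('v \<Rightarrow> real) \<Rightarrow> bool" where
  "lin_equiv V E D1 D2 \<longleftrightarrow> (\<exists>f. (\<lambda>v. D1 v - D2 v) = Q V E f)"

definition linear_system ::
    "'v set \<Rightarrow> 'v set multiset \<Rightarrow> ('v \<Rightarrow> real) \<Rightarrow> ('v \<Rightarrow> real) set" where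
  "linear_system V E D = {D'. effective V D' \<and> lin_equiv V E D' D}"

text \<open>
  For nonempty \<open>V\<close> the set below is nonempty (it contains every real number that is non-negative
  and larger than the degree of \<open>D\<close>) and bounded below by \<open>0\<close>, so the real infimum is the true one.
\<close>

definition modified_rank :: "'v set \<Rightarrow> 'v set multiset \<Rightarrow> ('v \<Rightarrow> real) \<Rightarrow> real" where
  "modified_rank V E D =
     Inf {k. \<exists>F. effective V F \<and> deg V F = k \<and> linear_system V E (\<lambda>v. D v - F v) = {}} - 1"

definition div_rank :: "'v set \<Rightarrow> 'v set multiset \<Rightarrow> ('v \<Rightarrow> real) \<Rightarrow> real" where
  "div_rank V E D = modified_rank V E (\<lambda>v. D v + (if v \<in> V then 1 else 0))"

end

theory Submission
  imports Defs
begin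

text \<open>
  Write \<open>n\<close> and \<open>m\<close> for the numbers of vertices and edges, \<open>a = r + 1\<close> and \<open>b = g - d + r\<close>,
  and shift divisors by the all-ones divisor: with \<open>X = D + \<Sum>(v)\<close>, the number \<open>r(D) + 1\<close> is
  the infimum \<open>k(X)\<close> of the degrees of effective \<open>F\<close> for which \<open>X - F\<close> has empty linear
  system (\<open>emptying_degree\<close>). Degree \<open>d\<close> for \<open>D\<close> means degree \<open>d + n = m + a - b\<close>
  for \<open>X\<close>.

  Since real coefficients are allowed, \<open>k\<close> is Lipschitz along the all-ones direction and vanishes in
  negative degree. By the intermediate value theorem (\<open>emptying_degree_attains\<close>) it is therefore
  enough to find \<open>X\<close> of degree \<open>m + a - b\<close> with \<open>k(X) \<ge> a\<close>. There are two candidates,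
  dual to each other in the sense of Riemann-Roch.

  If \<open>X \<ge> a\<close> at every vertex, then \<open>X - F\<close> is effective whenever \<open>deg F < a\<close>, so
  \<open>k(X) \<ge> a\<close>. The degree leaves room for such an \<open>X\<close> exactly if
  \<open>b + (n - 1) a \<le> m\<close>.

  If \<open>X(v)\<close> is at most the valency of \<open>v\<close> minus \<open>b\<close> for all \<open>v\<close>, then \<open>k(X) \<ge> a\<close>
  as well, and there is room for such an \<open>X\<close> exactly if \<open>a + (n - 1) b \<le> m\<close>. Indeed, if
  \<open>X - F\<close> has empty linear system, then Dhar's burning algorithm gives a function \<open>f\<close> and a
  linear order on the vertices such that \<open>X - F \<le> \<mu>\<close>, where \<open>\<mu>\<close> is the indegree divisor of
  the order plus \<open>Q f\<close> (\<open>empty_system_below_indegrees\<close>). At the last vertex among those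
  that maximize \<open>f\<close>, the value of \<open>\<mu>\<close> is at least the valency, so \<open>\<mu>\<close> exceeds
  \<open>X - F\<close> there by at least \<open>b\<close>; as \<open>\<mu>\<close> has degree \<open>m\<close>, this gives
  \<open>deg (X - F) \<le> m - b\<close>, that is \<open>deg F \<ge> a\<close>.

  Finally, the numerical hypothesis implies one of the two inequalities
  (\<open>stretch_dichotomy\<close>); the stretch factor is just large enough for this.
\<close>

section \<open>The Laplacian of a multigraph\<close>

lemma Q_eq:
  "v \<in> V \<Longrightarrow> Q V E f v = (\<Sum>u\<in>V. real (count E {u, v}) * (of_int (f v) - of_int (f u)))"
  by (simp add: Q_def)

lemma Q_outside [simp]: "v \<notin> V \<Longrightarrow> Q V E f v = 0"
  by (simp add: Q_def)

lemma Q_add: "Q V E (\<lambda>x. f x + g x) v = Q V E f v + Q V E g v"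
  by (cases "v \<in> V") (simp_all add: Q_eq sum.distrib [symmetric] algebra_simps)

lemma Q_minus: "Q V E (\<lambda>x. - f x) v = - Q V E f v"
  by (cases "v \<in> V") (simp_all add: Q_eq sum_negf [symmetric] algebra_simps)

lemma Q_zero: "Q V E (\<lambda>x. 0) v = 0"
  by (simp add: Q_def)

lemma Q_indicator_inside:
  assumes "finite V" "A \<subseteq> V" "v \<in> A"
  shows "Q V E (\<lambda>x. if x \<in> A then t else 0) v = of_int t * (\<Sum>u\<in>V - A. real (count E {u, v}))"
proof -
  have "Q V E (\<lambda>x. if x \<in> A then t else 0) v
      = (\<Sum>u\<in>V. if u \<in> V - A then of_int t * real (count E {u, v}) else 0)"
    using assms by (subst Q_eq) (auto intro!: sum.cong)
  also have "\<dots> = (\<Sum>u\<in>V - A. of_int t * real (count E {u, v}))"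
    using assms by (subst sum.inter_restrict [symmetric]) (auto intro!: sum.cong)
  finally show ?thesis
    by (simp add: sum_distrib_left)
qed

lemma Q_indicator_outside:
  assumes "finite V" "A \<subseteq> V" "v \<in> V - A"
  shows "Q V E (\<lambda>x. if x \<in> A then t else 0) v = - of_int t * (\<Sum>u\<in>A. real (count E {u, v}))"
proof -
  have "Q V E (\<lambda>x. if x \<in> A then t else 0) v
      = (\<Sum>u\<in>V. if u \<in> A then - of_int t * real (count E {u, v}) else 0)"
    using assms by (subst Q_eq) (auto intro!: sum.cong)
  also have "\<dots> = (\<Sum>u\<in>A. - of_int t * real (count E {u, v}))"
    using assms by (subst sum.inter_restrict [symmetric]) (auto intro!: sum.cong)
  finally show ?thesis
    by (simp add: sum_distrib_left)
qed

lemma sum_Q: "(\<Sum>v\<in>V. Q V E f v) = 0"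
proof -
  have "(\<Sum>v\<in>V. Q V E f v)
      = (\<Sum>v\<in>V. \<Sum>u\<in>V. real (count E {u, v}) * of_int (f v))
        - (\<Sum>v\<in>V. \<Sum>u\<in>V. real (count E {u, v}) * of_int (f u))"
    by (simp add: Q_eq sum_subtractf [symmetric] algebra_simps)
  also have "(\<Sum>v\<in>V. \<Sum>u\<in>V. real (count E {u, v}) * of_int (f u))
      = (\<Sum>v\<in>V. \<Sum>u\<in>V. real (count E {u, v}) * of_int (f v))"
    by (subst sum.swap) (simp add: insert_commute)
  finally show ?thesis by simp
qed

lemma no_loops: "multigraph V E \<Longrightarrow> count E {v} = 0"
  unfolding multigraph_def by (metis card.empty card_insert_disjoint count_inI empty_iff
      finite.emptyI numeral_2_eq_2 n_not_Suc_n)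

lemma handshake:
  assumes "multigraph V E"
  shows "(\<Sum>v\<in>V. \<Sum>u\<in>V. count E {u, v}) = 2 * size E"
proof -
  have fin: "finite V" using assms by (simp add: multigraph_def)
  have "\<forall>e \<in># E. e \<subseteq> V \<and> card e = 2"
    using assms by (simp add: multigraph_def)
  then show ?thesis
  proof (induction E)
    case empty
    then show ?case by simp
  next
    case (add e E)
    obtain x y where e: "e = {x, y}" "x \<noteq> y"
      using add.prems by (auto simp: card_2_iff)
    have xy: "x \<in> V" "y \<in> V" using add.prems e by auto
    have "(\<Sum>v\<in>V. \<Sum>u\<in>V. if {u, v} = e then 1 else (0::nat))
        = (\<Sum>v\<in>V. (if v = x then 1 else 0) + (if v = y then 1 else 0))"
    proof (rule sum.cong [OF refl])
      fix v assume "v \<in> V"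
      have "(\<Sum>u\<in>V. if {u, v} = e then 1 else (0::nat))
          = (\<Sum>u\<in>V. (if u = y then if v = x then 1 else 0 else 0)
                    + (if u = x then if v = y then 1 else 0 else 0))"
        using e by (intro sum.cong) (auto simp: doubleton_eq_iff)
      also have "\<dots> = (if v = x then 1 else 0) + (if v = y then 1 else 0)"
        using fin xy by (simp add: sum.distrib)
      finally show "(\<Sum>u\<in>V. if {u, v} = e then 1 else (0::nat)) = \<dots>" .
    qed
    also have "\<dots> = 2"
      using fin xy by (simp add: sum.distrib)
    finally have "(\<Sum>v\<in>V. \<Sum>u\<in>V. if {u, v} = e then 1 else (0::nat)) = 2" .
    moreover have "(\<Sum>v\<in>V. \<Sum>u\<in>V. count (add_mset e E) {u, v})
        = (\<Sum>v\<in>V. \<Sum>u\<in>V. count E {u, v}) + (\<Sum>v\<in>V. \<Sum>u\<in>V. if {u, v} = e then 1 else 0)"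
      by (simp add: sum.distrib [symmetric] if_distrib cong: if_cong)
        (intro sum.cong; auto)
    ultimately show ?case using add by simp
  qed
qed

text \<open>Each edge points to exactly one of its ends when the vertices are linearly ordered.\<close>

lemma sum_indegrees:
  fixes \<rho> :: "'v \<Rightarrow> nat"
  assumes "multigraph V E" "inj_on \<rho> V"
  shows "(\<Sum>v\<in>V. \<Sum>u\<in>{u\<in>V. \<rho> u < \<rho> v}. real (count E {u, v})) = real (size E)"
proof -
  have fin: "finite V" using assms by (simp add: multigraph_def)
  let ?c = "\<lambda>u v. real (count E {u, v})"
  let ?S = "\<Sum>v\<in>V. \<Sum>u\<in>V. if \<rho> u < \<rho> v then ?c u v else 0"
  have "(\<Sum>v\<in>V. \<Sum>u\<in>V. ?c u v)
      = (\<Sum>v\<in>V. \<Sum>u\<in>V. (if \<rho> u < \<rho> v then ?c u v else 0) + (if \<rho> v < \<rho> u then ?c u v else 0))"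
  proof (intro sum.cong refl)
    fix u v assume "u \<in> V" "v \<in> V"
    then show "?c u v = (if \<rho> u < \<rho> v then ?c u v else 0) + (if \<rho> v < \<rho> u then ?c u v else 0)"
      using no_loops [OF assms(1), of v] assms(2)
      by (cases "u = v") (auto dest: inj_onD simp: neq_iff)
  qed
  also have "\<dots> = ?S + (\<Sum>v\<in>V. \<Sum>u\<in>V. if \<rho> v < \<rho> u then ?c u v else 0)"
    by (simp add: sum.distrib)
  also have "(\<Sum>v\<in>V. \<Sum>u\<in>V. if \<rho> v < \<rho> u then ?c u v else 0) = ?S"
    by (subst sum.swap) (intro sum.cong refl, simp add: insert_commute)
  finally have "2 * ?S = real (\<Sum>v\<in>V. \<Sum>u\<in>V. count E {u, v})"
    by simp
  then have "?S = real (size E)"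
    using handshake [OF assms(1)] by simp
  moreover have "?S = (\<Sum>v\<in>V. \<Sum>u\<in>{u\<in>V. \<rho> u < \<rho> v}. ?c u v)"
    using fin by (simp add: sum.inter_filter)
  ultimately show ?thesis by simp
qed

section \<open>Consequences of connectedness\<close>

lemma crossing_edge:
  assumes "connected_multigraph V E" "S \<subseteq> V" "S \<noteq> {}" "S \<noteq> V"
  obtains u v where "u \<in> S" "v \<in> V - S" "count E {u, v} > 0"
proof -
  obtain a b where a: "a \<in> S" and b: "b \<in> V - S" using assms by auto
  have "(a, b) \<in> {(x, y). {x, y} \<in># E}\<^sup>*"
    using assms a b by (auto simp: connected_multigraph_def)
  moreover have "y \<in> S"
    if "(a, y) \<in> {(x, y). {x, y} \<in># E}\<^sup>*" "\<And>u v. u \<in> S \<Longrightarrow> v \<in> V - S \<Longrightarrow> {u, v} \<notin># E" for y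
    using that(1)
  proof induction
    case base
    then show ?case by (rule a)
  next
    case (step y z)
    then have "z \<in> V"
      using assms(1) by (auto simp: connected_multigraph_def multigraph_def)
    then show ?case using step that(2) by auto
  qed
  ultimately obtain u v where "u \<in> S" "v \<in> V - S" "{u, v} \<in># E"
    using b by blast
  then show ?thesis using that by simp
qed

text \<open>Minimum principle: a function that is superharmonic away from \<open>q\<close> attains its minimum
  at \<open>q\<close>.\<close>

lemma minimum_principle:
  assumes conn: "connected_multigraph V E" and q: "q \<in> V"
    and super: "\<And>v. v \<in> V - {q} \<Longrightarrow> Q V E f v \<ge> 0"
    and v: "v \<in> V"
  shows "f q \<le> f v"
proof (rule ccontr)
  assume less: "\<not> f q \<le> f v"
  have fin: "finite V" using conn by (simp add: connected_multigraph_def multigraph_def)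
  define T where "T = {x \<in> V. f x = Min (f ` V)}"
  have "Min (f ` V) \<in> f ` V" using fin q by (intro Min_in) auto
  then have "T \<noteq> {}" unfolding T_def by auto
  have min: "x \<in> T \<Longrightarrow> y \<in> V \<Longrightarrow> f x \<le> f y" for x y
    using fin by (simp add: T_def)
  have "q \<notin> T" using min [of q v] less v by auto
  then obtain x y where x: "x \<in> T" and y: "y \<in> V - T" and e: "count E {x, y} > 0"
    using crossing_edge [OF conn, of T] \<open>T \<noteq> {}\<close> q by (auto simp: T_def)
  have "f x < f y" using min [OF x, of y] x y by (auto simp: T_def)
  have "x \<in> V - {q}" using x \<open>q \<notin> T\<close> by (auto simp: T_def)
  have "Q V E f x < (\<Sum>u\<in>V. 0)"
    unfolding Q_eq [OF DiffD1 [OF \<open>x \<in> V - {q}\<close>]]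
  proof (rule sum_strict_mono_ex1 [OF fin])
    show "\<forall>u\<in>V. real (count E {u, x}) * (of_int (f x) - of_int (f u)) \<le> 0"
      using min [OF x] by (simp add: mult_le_0_iff)
    show "\<exists>u\<in>V. real (count E {u, x}) * (of_int (f x) - of_int (f u)) < 0"
      using y e \<open>f x < f y\<close> by (intro bexI [of _ y]) (auto simp: mult_less_0_iff insert_commute)
  qed
  then show False using super [OF \<open>x \<in> V - {q}\<close>] by simp
qed

text \<open>Chips can be moved so as to enrich every vertex outside \<open>S\<close>. The vertices outside \<open>S\<close> are
  treated one at a time: once all others outside \<open>S \<union> {v}\<close> are rich, adding a
  constant to \<open>h\<close> on the complement of \<open>S\<close> brings chips to \<open>v\<close> across an edge from
  \<open>S\<close> and makes none of the others poorer.\<close>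

lemma superharmonic_exists:
  assumes conn: "connected_multigraph V E" and "S \<subseteq> V" "S \<noteq> {}"
  shows "\<exists>h. (\<forall>v\<in>V - S. Q V E h v \<ge> c) \<and> (\<forall>v\<in>S. h v = 0)"
  using assms(2,3)
proof (induction "card (V - S)" arbitrary: S)
  case 0
  then have "V - S = {}"
    using conn by (simp add: connected_multigraph_def multigraph_def)
  then show ?case by (intro exI [of _ "\<lambda>_. 0"]) auto
next
  case (Suc k)
  have fin: "finite V" using conn by (simp add: connected_multigraph_def multigraph_def)
  have "S \<noteq> V" using Suc.hyps(2) by auto
  then obtain u v where uv: "u \<in> S" "v \<in> V - S" "count E {u, v} > 0"
    using crossing_edge [OF conn Suc.prems] by metis
  have "V - insert v S = (V - S) - {v}" by auto
  then have "k = card (V - insert v S)"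
    using Suc.hyps(2) uv fin by simp
  then obtain h where h: "\<forall>x\<in>V - insert v S. Q V E h x \<ge> c" "\<forall>x\<in>insert v S. h x = 0"
    using Suc.hyps(1) [of "insert v S"] Suc.prems uv by auto
  define t where "t = max 0 \<lceil>c - Q V E h v\<rceil>"
  define h' where "h' = (\<lambda>x. h x + (if x \<in> V - S then t else 0))"
  have Q': "Q V E h' x = Q V E h x + of_int t * (\<Sum>u\<in>S. real (count E {u, x}))"
    if "x \<in> V - S" for x
    unfolding h'_def Q_add
    using Q_indicator_inside [OF fin Diff_subset that, of E t] Suc.prems
    by (simp add: double_diff)
  have t: "t \<ge> 0" "of_int t \<ge> c - Q V E h v"
    unfolding t_def by linarith+
  have "Q V E h' x \<ge> c" if x: "x \<in> V - S" for x
  proof (cases "x = v")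
    case True
    have "1 \<le> real (count E {u, v})" using uv by simp
    also have "\<dots> \<le> (\<Sum>u\<in>S. real (count E {u, v}))"
      using uv Suc.prems fin by (intro member_le_sum) (auto intro: finite_subset)
    finally have "of_int t * 1 \<le> of_int t * (\<Sum>u\<in>S. real (count E {u, v}))"
      using t by (intro mult_left_mono) auto
    then show ?thesis using Q' [OF x] t True by simp
  next
    case False
    have "0 \<le> of_int t * (\<Sum>u\<in>S. real (count E {u, x}))"
      using t by (intro mult_nonneg_nonneg sum_nonneg) auto
    moreover have "Q V E h x \<ge> c" using h x False by auto
    ultimately show ?thesis using Q' [OF x] by simp
  qed
  moreover have "\<forall>x\<in>S. h' x = 0" using h by (auto simp: h'_def)
  ultimately show ?case by blast
qed

section \<open>Reduced divisors and linear orders\<close>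

text \<open>Every class has a representative that is non-negative away from \<open>q\<close> and from which no set
  \<open>A\<close> avoiding \<open>q\<close> can fire without creating debt. Among the functions \<open>f\<close> with \<open>f q = 0\<close>
  and \<open>X + Q f\<close> non-negative away from \<open>q\<close>, the minimum principle gives a common lower bound,
  so one of them has the least sum; firing \<open>A\<close>, that is subtracting its indicator from \<open>f\<close>,
  would lower that sum.\<close>

lemma reduced_representative:
  assumes conn: "connected_multigraph V E" and q: "q \<in> V"
  shows "\<exists>f. (\<forall>v\<in>V - {q}. X v + Q V E f v \<ge> 0) \<and>
    (\<forall>A. A \<subseteq> V - {q} \<longrightarrow> A \<noteq> {} \<longrightarrow>
      (\<exists>v\<in>A. X v + Q V E f v < (\<Sum>u\<in>V - A. real (count E {u, v}))))"
proof -
  have fin: "finite V" using conn by (simp add: connected_multigraph_def multigraph_def)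
  define P where "P f \<longleftrightarrow> f q = 0 \<and> (\<forall>v\<in>V - {q}. X v + Q V E f v \<ge> 0)" for f
  define c where "c = (\<Sum>v\<in>V. \<bar>X v\<bar>)"
  have c: "\<bar>X v\<bar> \<le> c" if "v \<in> V" for v
    unfolding c_def using that fin by (intro member_le_sum) auto
  obtain h where h: "\<forall>v\<in>V - {q}. Q V E h v \<ge> c" "h q = 0"
    using superharmonic_exists [OF conn, of "{q}" c] q by auto
  have "0 \<le> X v + Q V E h v" if "v \<in> V - {q}" for v
  proof -
    have "c \<le> Q V E h v" "\<bar>X v\<bar> \<le> c" using h c [of v] that by auto
    then show ?thesis by linarith
  qed
  then have "P h" using h by (simp add: P_def)
  have lower: "f v + h v \<ge> 0" if "P f" "v \<in> V" for f v
  proof -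
    have "f q + h q \<le> f v + h v"
    proof (rule minimum_principle [OF conn q _ that(2), of "\<lambda>x. f x + h x"])
      fix x assume x: "x \<in> V - {q}"
      have "X x + Q V E f x \<ge> 0" using that(1) x by (simp add: P_def)
      moreover have "Q V E h x \<ge> c" using h x by simp
      moreover have "X x \<le> c" using c [of x] x by auto
      ultimately show "Q V E (\<lambda>x. f x + h x) x \<ge> 0" by (simp add: Q_add)
    qed
    then show ?thesis using that(1) h by (simp add: P_def)
  qed
  obtain f where f: "P f"
    and least: "\<And>g. P g \<Longrightarrow> nat (\<Sum>v\<in>V. f v + h v) \<le> nat (\<Sum>v\<in>V. g v + h v)"
    using ex_has_least_nat [of P h "\<lambda>f. nat (\<Sum>v\<in>V. f v + h v)"] \<open>P h\<close> by blast
  have "\<exists>v\<in>A. X v + Q V E f v < (\<Sum>u\<in>V - A. real (count E {u, v}))"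
    if A: "A \<subseteq> V - {q}" "A \<noteq> {}" for A
  proof (rule ccontr)
    assume "\<not> ?thesis"
    then have rich: "X v + Q V E f v \<ge> (\<Sum>u\<in>V - A. real (count E {u, v}))" if "v \<in> A" for v
      using that by force
    have AV: "A \<subseteq> V" using A by auto
    define g where "g = (\<lambda>x. f x + (if x \<in> A then - 1 else 0))"
    have "P g" unfolding P_def
    proof (intro conjI ballI)
      show "g q = 0" using f A by (auto simp: P_def g_def)
      fix v assume v: "v \<in> V - {q}"
      have Qg: "Q V E g v = Q V E f v + Q V E (\<lambda>x. if x \<in> A then - 1 else 0) v"
        by (simp add: g_def Q_add)
      show "X v + Q V E g v \<ge> 0"
      proof (cases "v \<in> A")
        case True
        then show ?thesis
          using Qg Q_indicator_inside [OF fin AV True, of E "- 1"] rich [OF True] by simp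
      next
        case False
        have "(\<Sum>u\<in>A. real (count E {u, v})) \<ge> 0" by (simp add: sum_nonneg)
        moreover have "X v + Q V E f v \<ge> 0" using f v by (simp add: P_def)
        ultimately show ?thesis
          using Qg Q_indicator_outside [OF fin AV, of v E "- 1"] v False by simp
      qed
    qed
    have "(\<Sum>v\<in>V. g v + h v) = (\<Sum>v\<in>V. f v + h v) + (\<Sum>v\<in>V. if v \<in> A then - 1 else 0)"
      by (simp add: g_def sum.distrib)
    also have "(\<Sum>v\<in>V. if v \<in> A then - 1 else 0) = - int (card A)"
      using fin AV by (simp add: sum.inter_restrict [symmetric] Int_absorb1)
    finally have "(\<Sum>v\<in>V. g v + h v) < (\<Sum>v\<in>V. f v + h v)"
      using A finite_subset [OF AV fin] by (simp add: card_gt_0_iff)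
    moreover have "(\<Sum>v\<in>V. g v + h v) \<ge> 0"
      using lower [OF \<open>P g\<close>] by (simp add: sum_nonneg)
    ultimately show False using least [OF \<open>P g\<close>] by linarith
  qed
  then show ?thesis using f unfolding P_def by blast
qed

text \<open>Dhar's burning order. A set \<open>A\<close> of unburnt vertices always contains a vertex whose chips
  do not outnumber its edges to the burnt ones; that vertex burns next. The order \<open>\<rho>\<close> records
  the time of burning.\<close>

lemma burning_order:
  fixes X :: "'v \<Rightarrow> real" and c :: "'v \<Rightarrow> 'v \<Rightarrow> real"
  assumes fin: "finite V"
    and burn: "\<And>A. A \<subseteq> V \<Longrightarrow> A \<noteq> {} \<Longrightarrow> \<exists>v\<in>A. X v \<le> (\<Sum>u\<in>V - A. c u v)"
    and "A \<subseteq> V"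
  shows "\<exists>\<rho> :: 'v \<Rightarrow> nat. inj_on \<rho> A \<and>
    (\<forall>v\<in>A. X v \<le> (\<Sum>u\<in>V - A. c u v) + (\<Sum>u\<in>{u\<in>A. \<rho> u < \<rho> v}. c u v))"
  using assms(3)
proof (induction "card A" arbitrary: A)
  case 0
  then have "A = {}" using fin finite_subset by fastforce
  then show ?case by simp
next
  case (Suc k)
  then have "A \<noteq> {}" by auto
  then obtain v where v: "v \<in> A" "X v \<le> (\<Sum>u\<in>V - A. c u v)"
    using burn Suc.prems by blast
  have finA: "finite A" using Suc.prems fin finite_subset by blast
  have "k = card (A - {v})" using Suc.hyps(2) v finA by simp
  then obtain \<rho> :: "'v \<Rightarrow> nat" where inj: "inj_on \<rho> (A - {v})"
    and \<rho>: "\<And>x. x \<in> A - {v} \<Longrightarrow>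
      X x \<le> (\<Sum>u\<in>V - (A - {v}). c u x) + (\<Sum>u\<in>{u\<in>A - {v}. \<rho> u < \<rho> x}. c u x)"
    using Suc.hyps(1) [OF _ subset_trans [OF Diff_subset Suc.prems]] by blast
  define \<sigma> where "\<sigma> x = (if x = v then 0 else Suc (\<rho> x))" for x
  have "inj_on \<sigma> A"
    using inj by (auto simp: inj_on_def \<sigma>_def)
  moreover have "X x \<le> (\<Sum>u\<in>V - A. c u x) + (\<Sum>u\<in>{u\<in>A. \<sigma> u < \<sigma> x}. c u x)" if x: "x \<in> A" for x
  proof (cases "x = v")
    case True
    then show ?thesis using v by (simp add: \<sigma>_def)
  next
    case False
    have 1: "V - (A - {v}) = insert v (V - A)" using v Suc.prems by auto
    have 2: "{u\<in>A. \<sigma> u < \<sigma> x} = insert v {u\<in>A - {v}. \<rho> u < \<rho> x}"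
      using v False by (auto simp: \<sigma>_def)
    have "(\<Sum>u\<in>V - (A - {v}). c u x) = c v x + (\<Sum>u\<in>V - A. c u x)"
      unfolding 1 using v fin by simp
    moreover have "(\<Sum>u\<in>{u\<in>A. \<sigma> u < \<sigma> x}. c u x)
        = c v x + (\<Sum>u\<in>{u\<in>A - {v}. \<rho> u < \<rho> x}. c u x)"
      unfolding 2 using finA by (subst sum.insert) auto
    ultimately show ?thesis using \<rho> [of x] x False by simp
  qed
  ultimately show ?case by blast
qed

lemma linear_system_nonempty_iff:
  assumes "X \<in> divisors V"
  shows "linear_system V E X \<noteq> {} \<longleftrightarrow> (\<exists>f. \<forall>v\<in>V. X v + Q V E f v \<ge> 0)"
proof
  assume "linear_system V E X \<noteq> {}"
  then obtain Y f where "effective V Y" "(\<lambda>v. Y v - X v) = Q V E f"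
    by (auto simp: linear_system_def lin_equiv_def)
  then have "X v + Q V E f v = Y v" for v
    by (metis add_diff_cancel_left' add_diff_eq)
  then show "\<exists>f. \<forall>v\<in>V. X v + Q V E f v \<ge> 0"
    using \<open>effective V Y\<close> by (auto simp: effective_def intro!: exI [of _ f])
next
  assume "\<exists>f. \<forall>v\<in>V. X v + Q V E f v \<ge> 0"
  then obtain f where "\<forall>v\<in>V. X v + Q V E f v \<ge> 0" by blast
  then have "(\<lambda>v. X v + Q V E f v) \<in> linear_system V E X"
    using assms by (auto simp: linear_system_def effective_def lin_equiv_def divisors_def)
  then show "linear_system V E X \<noteq> {}" by blast
qed

text \<open>A divisor with empty linear system lies, up to linear equivalence, below the indegree
  divisor of a linear order on the vertices.\<close>

lemma empty_system_below_indegrees: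
  fixes V :: "'v set"
  assumes conn: "connected_multigraph V E" and X: "X \<in> divisors V" "linear_system V E X = {}"
  shows "\<exists>f (\<rho> :: 'v \<Rightarrow> nat). inj_on \<rho> V \<and>
    (\<forall>v\<in>V. X v \<le> (\<Sum>u\<in>{u\<in>V. \<rho> u < \<rho> v}. real (count E {u, v})) + Q V E f v)"
proof -
  have fin: "finite V" and "V \<noteq> {}"
    using conn by (auto simp: connected_multigraph_def multigraph_def)
  then obtain q where q: "q \<in> V" by auto
  obtain f where f: "\<forall>v\<in>V - {q}. X v + Q V E f v \<ge> 0"
    and red: "\<And>A. A \<subseteq> V - {q} \<Longrightarrow> A \<noteq> {} \<Longrightarrow>
      \<exists>v\<in>A. X v + Q V E f v < (\<Sum>u\<in>V - A. real (count E {u, v}))"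
    using reduced_representative [OF conn q, of X] by blast
  have "\<not> (\<forall>v\<in>V. X v + Q V E f v \<ge> 0)"
    using linear_system_nonempty_iff [OF X(1)] X(2) by blast
  then have debt: "X q + Q V E f q < 0" using f by force
  have "\<exists>v\<in>A. X v + Q V E f v \<le> (\<Sum>u\<in>V - A. real (count E {u, v}))"
    if "A \<subseteq> V" "A \<noteq> {}" for A
  proof (cases "q \<in> A")
    case True
    have "0 \<le> (\<Sum>u\<in>V - A. real (count E {u, q}))" by (simp add: sum_nonneg)
    then show ?thesis using debt True by (intro bexI [of _ q]) auto
  next
    case False
    then have "A \<subseteq> V - {q}" using that by auto
    from red [OF this \<open>A \<noteq> {}\<close>] show ?thesis by (auto intro: less_imp_le)
  qed
  from burning_order [OF fin this subset_refl]
  obtain \<rho> :: "'v \<Rightarrow> nat" where "inj_on \<rho> V"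
    "\<forall>v\<in>V. X v + Q V E f v \<le> (\<Sum>u\<in>{u\<in>V. \<rho> u < \<rho> v}. real (count E {u, v}))"
    by auto
  then show ?thesis
    by (intro exI [of _ "\<lambda>x. - f x"] exI [of _ \<rho>]) (auto simp: Q_minus algebra_simps)
qed

text \<open>The vertex that comes last in the order among those where \<open>f\<close> is maximal receives all its
  edges, so there the dominating divisor is at least the valency and exceeds \<open>X\<close> by at least
  \<open>b\<close>. The dominating divisor has degree \<open>size E\<close>.\<close>

lemma degree_le_of_empty_system:
  fixes V :: "'v set"
  assumes conn: "connected_multigraph V E" and X: "X \<in> divisors V" "linear_system V E X = {}"
    and below: "\<And>v. v \<in> V \<Longrightarrow> X v \<le> (\<Sum>u\<in>V. real (count E {u, v})) - b"
  shows "deg V X \<le> real (size E) - b"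
proof -
  have mg: "multigraph V E" and fin: "finite V" and "V \<noteq> {}"
    using conn by (auto simp: connected_multigraph_def multigraph_def)
  obtain f and \<rho> :: "'v \<Rightarrow> nat" where inj: "inj_on \<rho> V"
    and dom: "\<And>v. v \<in> V \<Longrightarrow>
      X v \<le> (\<Sum>u\<in>{u\<in>V. \<rho> u < \<rho> v}. real (count E {u, v})) + Q V E f v"
    using empty_system_below_indegrees [OF conn X] by blast
  define \<mu> where "\<mu> v = (\<Sum>u\<in>{u\<in>V. \<rho> u < \<rho> v}. real (count E {u, v})) + Q V E f v" for v
  define T where "T = {x \<in> V. f x = Max (f ` V)}"
  have "Max (f ` V) \<in> f ` V" using fin \<open>V \<noteq> {}\<close> by (intro Max_in) auto
  then have T: "T \<noteq> {}" "finite T" unfolding T_def using fin by auto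
  then have "Max (\<rho> ` T) \<in> \<rho> ` T" by (intro Max_in) auto
  then obtain v where v: "v \<in> T" "\<rho> v = Max (\<rho> ` T)" by auto
  have vV: "v \<in> V" using v by (simp add: T_def)
  have fmax: "f u \<le> f v" if "u \<in> V" for u
    using v that fin by (simp add: T_def)
  have last: "\<rho> u < \<rho> v" if "u \<in> V" "u \<noteq> v" "f u = f v" for u
  proof -
    have "u \<in> T" using that v by (simp add: T_def)
    then have "\<rho> u \<le> \<rho> v" using v T by simp
    moreover have "\<rho> u \<noteq> \<rho> v" using inj that vV by (auto dest: inj_onD)
    ultimately show ?thesis by simp
  qed
  have "(\<Sum>u\<in>V. real (count E {u, v})) \<le>
      (\<Sum>u\<in>V. (if \<rho> u < \<rho> v then real (count E {u, v}) else 0)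
        + real (count E {u, v}) * (of_int (f v) - of_int (f u)))"
  proof (rule sum_mono)
    fix u assume u: "u \<in> V"
    show "real (count E {u, v}) \<le> (if \<rho> u < \<rho> v then real (count E {u, v}) else 0)
        + real (count E {u, v}) * (of_int (f v) - of_int (f u))"
    proof (cases "u = v \<or> f u = f v")
      case True
      then show ?thesis
        using last [OF u] no_loops [OF mg, of v] by (cases "u = v") auto
    next
      case False
      then have "f v - f u \<ge> 1" using fmax [OF u] by linarith
      then have "real_of_int (f v) - of_int (f u) \<ge> 1"
        by (metis of_int_1_le_iff of_int_diff)
      then have "real (count E {u, v}) * 1 \<le> real (count E {u, v}) * (of_int (f v) - of_int (f u))"
        by (intro mult_left_mono) auto
      then show ?thesis by auto
    qed
  qed
  also have "\<dots> = \<mu> v"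
    using vV fin by (simp add: \<mu>_def Q_eq sum.distrib sum.inter_filter)
  finally have "b \<le> \<mu> v - X v" using below [OF vV] by linarith
  also have "\<dots> \<le> (\<Sum>x\<in>V. \<mu> x - X x)"
    using dom fin vV by (intro member_le_sum) (auto simp: \<mu>_def)
  also have "\<dots> = real (size E) - deg V X"
    using sum_indegrees [OF mg inj] sum_Q [of V E f]
    by (simp add: \<mu>_def deg_def sum_subtractf sum.distrib)
  finally show ?thesis by simp
qed

section \<open>The infimum that defines the rank\<close>

text \<open>The infimum of the degrees of effective divisors whose removal empties the linear system of
  \<open>X\<close>; it is one more than the modified rank of \<open>X\<close>.\<close>

definition emptying_degree :: "'v set \<Rightarrow> 'v set multiset \<Rightarrow> ('v \<Rightarrow> real) \<Rightarrow> real" where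
  "emptying_degree V E X =
     Inf {k. \<exists>F. effective V F \<and> deg V F = k \<and> linear_system V E (\<lambda>v. X v - F v) = {}}"

lemma deg_diff: "deg V (\<lambda>v. X v - Y v) = deg V X - deg V Y"
  by (simp add: deg_def sum_subtractf)

lemma deg_add: "deg V (\<lambda>v. X v + Y v) = deg V X + deg V Y"
  by (simp add: deg_def sum.distrib)

lemma deg_nonneg: "effective V F \<Longrightarrow> deg V F \<ge> 0"
  by (simp add: deg_def effective_def sum_nonneg)

lemma negative_degree_empty:
  assumes "X \<in> divisors V" "deg V X < 0"
  shows "linear_system V E X = {}"
proof (rule ccontr)
  assume "linear_system V E X \<noteq> {}"
  then obtain f where "\<forall>v\<in>V. X v + Q V E f v \<ge> 0"
    using linear_system_nonempty_iff [OF assms(1)] by blast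
  then have "(\<Sum>v\<in>V. X v + Q V E f v) \<ge> 0" by (simp add: sum_nonneg)
  then show False using assms(2) sum_Q [of V E f] by (simp add: sum.distrib deg_def)
qed

lemma emptying_divisor_exists:
  assumes "finite V" "V \<noteq> {}" "X \<in> divisors V"
  shows "\<exists>F. effective V F \<and> linear_system V E (\<lambda>v. X v - F v) = {}"
proof -
  obtain q where q: "q \<in> V" using assms by auto
  define F where "F v = (if v = q then \<bar>deg V X\<bar> + 1 else 0)" for v
  have "effective V F" using q by (auto simp: effective_def divisors_def F_def)
  moreover have "deg V F = \<bar>deg V X\<bar> + 1" using assms q by (simp add: deg_def F_def)
  then have "linear_system V E (\<lambda>v. X v - F v) = {}"
    using assms(3) \<open>effective V F\<close>
    by (intro negative_degree_empty) (auto simp: deg_diff divisors_def effective_def)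
  ultimately show ?thesis by blast
qed

lemma emptying_degree_le:
  assumes "effective V F" "linear_system V E (\<lambda>v. X v - F v) = {}"
  shows "emptying_degree V E X \<le> deg V F"
  unfolding emptying_degree_def
  using assms by (intro cInf_lower bdd_belowI [of _ 0]) (auto simp: deg_nonneg)

lemma emptying_degree_ge:
  assumes "finite V" "V \<noteq> {}" "X \<in> divisors V"
    and "\<And>F. effective V F \<Longrightarrow> linear_system V E (\<lambda>v. X v - F v) = {} \<Longrightarrow> k \<le> deg V F"
  shows "k \<le> emptying_degree V E X"
  unfolding emptying_degree_def
  using emptying_divisor_exists [OF assms(1-3), of E] assms(4)
  by (intro cInf_greatest) auto

lemma linear_system_empty_mono:
  assumes "X \<in> divisors V" "Y \<in> divisors V" "\<And>v. v \<in> V \<Longrightarrow> X v \<le> Y v"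
    and "linear_system V E Y = {}"
  shows "linear_system V E X = {}"
proof (rule ccontr)
  assume "linear_system V E X \<noteq> {}"
  then obtain f where "\<forall>v\<in>V. X v + Q V E f v \<ge> 0"
    using linear_system_nonempty_iff [OF assms(1)] by blast
  then have "\<forall>v\<in>V. Y v + Q V E f v \<ge> 0"
    using assms(3) by (meson add_right_mono order.trans)
  then show False using linear_system_nonempty_iff [OF assms(2)] assms(4) by blast
qed

lemma emptying_degree_add_effective:
  assumes "finite V" "V \<noteq> {}" "X \<in> divisors V" "effective V P"
  shows "emptying_degree V E X \<le> emptying_degree V E (\<lambda>v. X v + P v)"
    and "emptying_degree V E (\<lambda>v. X v + P v) \<le> emptying_degree V E X + deg V P"
proof -
  have P: "P \<in> divisors V" "\<And>v. v \<in> V \<Longrightarrow> P v \<ge> 0"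
    using assms(4) by (auto simp: effective_def)
  have XP: "(\<lambda>v. X v + P v) \<in> divisors V" using assms(3) P by (auto simp: divisors_def)
  show "emptying_degree V E X \<le> emptying_degree V E (\<lambda>v. X v + P v)"
  proof (rule emptying_degree_ge [OF assms(1,2) XP])
    fix F assume F: "effective V F" "linear_system V E (\<lambda>v. X v + P v - F v) = {}"
    then have "linear_system V E (\<lambda>v. X v - F v) = {}"
      using assms(3) P
      by (intro linear_system_empty_mono [OF _ _ _ F(2)]) (auto simp: divisors_def effective_def)
    then show "emptying_degree V E X \<le> deg V F" by (rule emptying_degree_le [OF F(1)])
  qed
  have "emptying_degree V E (\<lambda>v. X v + P v) - deg V P \<le> emptying_degree V E X"
  proof (rule emptying_degree_ge [OF assms(1-3)])
    fix F assume F: "effective V F" "linear_system V E (\<lambda>v. X v - F v) = {}"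
    have "effective V (\<lambda>v. F v + P v)"
      using F(1) assms(4) by (auto simp: effective_def divisors_def)
    moreover have "(\<lambda>v. X v + P v - (F v + P v)) = (\<lambda>v. X v - F v)" by auto
    ultimately have "emptying_degree V E (\<lambda>v. X v + P v) \<le> deg V (\<lambda>v. F v + P v)"
      using F(2) by (intro emptying_degree_le) auto
    then show "emptying_degree V E (\<lambda>v. X v + P v) - deg V P \<le> deg V F"
      by (simp add: deg_add)
  qed
  then show "emptying_degree V E (\<lambda>v. X v + P v) \<le> emptying_degree V E X + deg V P" by simp
qed

text \<open>Along the direction of the all-ones divisor the emptying degree is Lipschitz continuous and
  vanishes far down, so it takes every value between \<open>0\<close> and its value at \<open>X\<close>.\<close>

lemma emptying_degree_attains:
  assumes V: "finite V" "V \<noteq> {}" and X: "X \<in> divisors V"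
    and a: "0 \<le> a" "a \<le> emptying_degree V E X"
  obtains Y where "Y \<in> divisors V" "deg V Y \<le> deg V X" "emptying_degree V E Y = a"
proof -
  define Z where "Z t = (\<lambda>v. X v + (if v \<in> V then t else 0))" for t :: real
  define k where "k t = emptying_degree V E (Z t)" for t
  have Zdiv: "Z t \<in> divisors V" for t using X by (auto simp: Z_def divisors_def)
  have degZ: "deg V (Z t) = deg V X + real (card V) * t" for t
    by (simp add: Z_def deg_add) (simp add: deg_def)
  have step: "k s \<le> k t \<and> k t \<le> k s + real (card V) * (t - s)" if "s \<le> t" for s t
  proof -
    let ?P = "\<lambda>v. if v \<in> V then t - s else 0"
    have "effective V ?P" using that by (auto simp: effective_def divisors_def)
    moreover have "(\<lambda>v. Z s v + ?P v) = Z t" by (auto simp: Z_def)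
    moreover have "deg V ?P = real (card V) * (t - s)" by (simp add: deg_def)
    ultimately show ?thesis
      using emptying_degree_add_effective [OF V Zdiv [of s], of ?P E] by (simp add: k_def)
  qed
  have "(real (card V))-lipschitz_on UNIV k"
  proof (rule lipschitz_onI)
    fix s t :: real
    show "dist (k s) (k t) \<le> real (card V) * dist s t"
      using step [of s t] step [of t s] by (cases "s \<le> t") (auto simp: dist_real_def)
  qed simp
  then have cont: "continuous_on UNIV k" by (rule lipschitz_on_continuous_on)
  define t0 where "t0 = - (\<bar>deg V X\<bar> + 1) / real (card V)"
  have n: "real (card V) > 0" using V by (simp add: card_gt_0_iff)
  have "deg V (Z t0) < 0" using n by (simp add: degZ t0_def)
  then have "linear_system V E (\<lambda>v. Z t0 v - 0) = {}"
    using negative_degree_empty [OF Zdiv] by simp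
  then have "k t0 \<le> deg V (\<lambda>_. 0)"
    unfolding k_def by (intro emptying_degree_le) (auto simp: effective_def divisors_def)
  then have "k t0 \<le> a" using a by (simp add: deg_def)
  moreover have "Z 0 = X" by (auto simp: Z_def)
  then have "a \<le> k 0" using a by (simp add: k_def)
  moreover have "t0 \<le> 0" using n by (simp add: t0_def divide_le_0_iff)
  ultimately obtain t where t: "t0 \<le> t" "t \<le> 0" "k t = a"
    using IVT' [of k t0 a 0] continuous_on_subset [OF cont] by blast
  have "deg V (Z t) \<le> deg V X" using t by (simp add: degZ mult_nonneg_nonpos)
  then show ?thesis using that [of "Z t"] Zdiv t by (simp add: k_def)
qed

section \<open>Divisors of large rank\<close>

lemma emptying_degree_ge_constant:
  assumes V: "finite V" "V \<noteq> {}" and X: "X \<in> divisors V"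
    and ge: "\<And>v. v \<in> V \<Longrightarrow> a \<le> X v"
  shows "a \<le> emptying_degree V E X"
proof (rule emptying_degree_ge [OF V X])
  fix F assume F: "effective V F" "linear_system V E (\<lambda>v. X v - F v) = {}"
  show "a \<le> deg V F"
  proof (rule ccontr)
    assume less: "\<not> a \<le> deg V F"
    have "F v \<le> deg V F" if "v \<in> V" for v
      unfolding deg_def using F(1) V that by (intro member_le_sum) (auto simp: effective_def)
    then have "\<forall>v\<in>V. X v - F v + Q V E (\<lambda>_. 0) v \<ge> 0"
      using ge less by (fastforce simp: Q_zero)
    moreover have "(\<lambda>v. X v - F v) \<in> divisors V"
      using X F(1) by (auto simp: divisors_def effective_def)
    ultimately show False using F(2) linear_system_nonempty_iff by blast
  qed
qed

lemma emptying_degree_ge_below_valency: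
  assumes conn: "connected_multigraph V E" and X: "X \<in> divisors V"
    and below: "\<And>v. v \<in> V \<Longrightarrow> X v \<le> (\<Sum>u\<in>V. real (count E {u, v})) - b"
  shows "deg V X - real (size E) + b \<le> emptying_degree V E X"
proof (rule emptying_degree_ge [OF _ _ X])
  show "finite V" "V \<noteq> {}"
    using conn by (auto simp: connected_multigraph_def multigraph_def)
  fix F assume F: "effective V F" "linear_system V E (\<lambda>v. X v - F v) = {}"
  have "deg V (\<lambda>v. X v - F v) \<le> real (size E) - b"
  proof (rule degree_le_of_empty_system [OF conn _ F(2)])
    show "(\<lambda>v. X v - F v) \<in> divisors V"
      using X F(1) by (auto simp: divisors_def effective_def)
    show "X v - F v \<le> (\<Sum>u\<in>V. real (count E {u, v})) - b" if "v \<in> V" for v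
      using below [OF that] F(1) that by (force simp: effective_def)
  qed
  then show "deg V X - real (size E) + b \<le> deg V F" by (simp add: deg_diff)
qed

text \<open>If the first conclusion failed then \<open>b (m - p b) < m - p\<close>, that is
  \<open>m (b - 1) < p (b\<^sup>2 - 1)\<close>, so \<open>p (p + 1) \<le> m < p (b + 1)\<close>, which forces \<open>b > p\<close>;
  but \<open>b\<^sup>2 \<le> a b \<le> m - p < p b\<close> forces \<open>b < p\<close>.\<close>

lemma sum_le_of_product_le:
  fixes a b m p :: real
  assumes "1 \<le> b" "b \<le> a" "a * b \<le> m - p" "p * (p + 1) \<le> m" "0 < p"
  shows "a + p * b \<le> m"
proof (rule ccontr)
  assume "\<not> ?thesis"
  then have "(m - p * b) * b < a * b" using assms(1) by (intro mult_strict_right_mono) auto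
  then have "m * b - p * b * b < m - p" using assms(3) by (simp add: algebra_simps)
  then have "m * (b - 1) < p * (b + 1) * (b - 1)" by (simp add: algebra_simps)
  then have mb: "m < p * (b + 1)" using assms(1) by (simp add: mult_less_cancel_right)
  then have "p * (p + 1) < p * (b + 1)" using assms(4) by linarith
  then have "p < b" using assms(5) by simp
  have "b * b \<le> a * b" using assms by (intro mult_right_mono) auto
  then have "b * b < p * b" using assms(3) mb by (simp add: algebra_simps)
  then show False using \<open>p < b\<close> assms by (simp add: mult_less_cancel_right)
qed

text \<open>Here \<open>a = r + 1\<close>, \<open>b = g - d + r\<close>, \<open>p = n - 1\<close> and \<open>m - p = g\<close>. Multiplying
  \<open>a\<close>, \<open>b\<close> and \<open>m\<close> by \<open>k\<close>, as if every edge were replaced by \<open>k\<close> parallel ones,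
  reduces the claim to the case \<open>k = 1\<close>.\<close>

lemma stretch_dichotomy:
  fixes a b m p k :: real
  assumes "1 \<le> a" "1 \<le> k" "1 \<le> p" and stretch: "p * (p + 1) \<le> k * m"
    and special: "a - b \<le> m - p - 1" and bn: "k * a * b \<le> m - p"
  shows "a + p * b \<le> m \<or> b + p * a \<le> m"
proof -
  have kpos: "0 < k" using assms by simp
  have cancel: "x \<le> m" if "k * x \<le> k * m" for x
    using that kpos by simp
  have "(k * a) * (k * b) = k * (k * a * b)" by (simp add: algebra_simps)
  also have "\<dots> \<le> k * (m - p)" using bn kpos by (intro mult_left_mono) auto
  also have "\<dots> \<le> k * m - p"
  proof -
    have "1 * p \<le> k * p" using assms by (intro mult_right_mono) auto
    then show ?thesis by (simp add: algebra_simps)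
  qed
  finally have prod: "(k * a) * (k * b) \<le> k * m - p" .
  have ka: "1 \<le> k * a" using mult_mono [of 1 k 1 a] assms by simp
  consider "k * b \<le> 1" | "1 \<le> k * b" "b \<le> a" | "a \<le> b" by linarith
  then show ?thesis
  proof cases
    case 1
    have "k * (a - b) \<le> k * (m - p - 1)" using special kpos by (intro mult_left_mono) auto
    moreover have "1 * (p + 1) \<le> k * (p + 1)" using assms by (intro mult_right_mono) auto
    moreover have "(p + 1) * (k * b) \<le> (p + 1) * 1" using 1 assms by (intro mult_left_mono) auto
    ultimately have "k * (a + p * b) \<le> k * m" by (simp add: algebra_simps)
    then show ?thesis using cancel by blast
  next
    case 2
    then have "k * a + p * (k * b) \<le> k * m"
      using sum_le_of_product_le [of "k * b" "k * a" "k * m" p] prod stretch assms kpos by simp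
    then have "k * (a + p * b) \<le> k * m" by (simp add: algebra_simps)
    then show ?thesis using cancel by blast
  next
    case 3
    then have "k * b + p * (k * a) \<le> k * m"
      using sum_le_of_product_le [of "k * a" "k * b" "k * m" p] prod stretch assms kpos ka
      by (simp add: mult.commute)
    then have "k * (b + p * a) \<le> k * m" by (simp add: algebra_simps)
    then show ?thesis using cancel by blast
  qed
qed

theorem theorem1p7:
  fixes V :: "'v set" and E :: "'v set multiset" and r d :: real
  assumes "connected_multigraph V E"
    and "card V \<ge> 2"
    and "genus V E \<ge> 1"
    and "r \<ge> 0" and "d \<ge> 0"
    and "d \<le> 2 * of_int (genus V E) - 2"
    and "of_int (genus V E)
           - of_int (stretch_factor V E) * (r + 1) * (of_int (genus V E) - d + r) \<ge> 0"
  shows "\<exists>D \<in> divisors V. deg V D \<le> d \<and> div_rank V E D = r"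
proof -
  note conn = assms(1)
  have mg: "multigraph V E" and V: "finite V" "V \<noteq> {}"
    using conn by (auto simp: connected_multigraph_def multigraph_def)
  define n m g k where "n = real (card V)" and "m = real (size E)"
    and "g = real_of_int (genus V E)" and "k = real_of_int (stretch_factor V E)"
  define a b where "a = r + 1" and "b = g - d + r"
  have n: "n \<ge> 2" using assms(2) by (simp add: n_def)
  have g: "g = m - (n - 1)" by (simp add: g_def m_def n_def genus_def)
  have m: "m > 0" using assms(3) n g by (simp add: g_def)
  have k: "1 \<le> k" and "n * (n - 1) / m \<le> k"
    by (auto simp: k_def stretch_factor_def n_def m_def le_max_iff_disj)
      (simp add: max_def; linarith)
  then have stretch: "(n - 1) * (n - 1 + 1) \<le> k * m"
    using m by (simp add: field_simps)
  have special: "a - b \<le> m - (n - 1) - 1"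
    using assms(6) g by (simp add: a_def b_def g_def)
  have bn: "k * a * b \<le> m - (n - 1)"
    using assms(7) g by (simp add: a_def b_def g_def k_def)
  have "a + (n - 1) * b \<le> m \<or> b + (n - 1) * a \<le> m"
    using stretch_dichotomy [OF _ k _ stretch special bn] assms(4) n by (simp add: a_def)
  then obtain X where X: "X \<in> divisors V" "deg V X = d + n" "a \<le> emptying_degree V E X"
  proof
    assume le: "a + (n - 1) * b \<le> m"
    \<comment> \<open>the valency divisor minus \<open>b\<close> everywhere, lowered evenly to degree \<open>d + n\<close>\<close>
    define \<delta> where "\<delta> = (m - a - (n - 1) * b) / n"
    define X where
      "X v = (if v \<in> V then (\<Sum>u\<in>V. real (count E {u, v})) - b - \<delta> else 0)" for v
    have "\<delta> \<ge> 0" using le n by (simp add: \<delta>_def)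
    have "X \<in> divisors V" by (simp add: X_def divisors_def)
    have "(\<Sum>v\<in>V. \<Sum>u\<in>V. real (count E {u, v})) = 2 * m"
      using arg_cong [OF handshake [OF mg], of real] by (simp add: m_def)
    then have "deg V X = 2 * m - n * b - n * \<delta>"
      by (simp add: deg_def X_def sum_subtractf n_def)
    also have "n * \<delta> = m - a - (n - 1) * b" using n by (simp add: \<delta>_def)
    finally have degX: "deg V X = m + a - b" by (simp add: algebra_simps)
    have "deg V X - m + b \<le> emptying_degree V E X"
      unfolding m_def
      by (rule emptying_degree_ge_below_valency [OF conn \<open>X \<in> divisors V\<close>])
        (use \<open>\<delta> \<ge> 0\<close> in \<open>simp add: X_def\<close>)
    then show ?thesis
      using that [of X] \<open>X \<in> divisors V\<close> degX g by (simp add: a_def b_def)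
  next
    assume le: "b + (n - 1) * a \<le> m"
    \<comment> \<open>degree \<open>d + n\<close>, spread evenly over the vertices\<close>
    define X where "X v = (if v \<in> V then (d + n) / n else 0)" for v
    have "X \<in> divisors V" by (simp add: X_def divisors_def)
    moreover have "deg V X = d + n" using n by (simp add: deg_def X_def n_def)
    moreover have "a * n \<le> d + n" using le g by (simp add: a_def b_def algebra_simps)
    then have "a \<le> (d + n) / n" using n by (simp add: field_simps)
    then have "a \<le> emptying_degree V E X"
      by (intro emptying_degree_ge_constant [OF V \<open>X \<in> divisors V\<close>]) (simp add: X_def)
    ultimately show ?thesis using that by blast
  qed
  obtain Y where Y: "Y \<in> divisors V" "deg V Y \<le> d + n" "emptying_degree V E Y = a"
    using emptying_degree_attains [OF V X(1) _ X(3)] X(2) assms(4) by (auto simp: a_def)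
  define D where "D v = Y v - (if v \<in> V then 1 else 0)" for v
  have "D \<in> divisors V" using Y(1) by (auto simp: D_def divisors_def)
  moreover have "deg V D \<le> d"
    unfolding D_def deg_diff using Y(2) by (simp add: n_def deg_def)
  moreover have "(\<lambda>v. D v + (if v \<in> V then 1 else 0)) = Y" by (simp add: D_def)
  then have "div_rank V E D = r"
    using Y(3) by (simp add: div_rank_def modified_rank_def emptying_degree_def a_def)
  ultimately show ?thesis by blast
qed

end
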